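(* Let $G$ be a finite simple undirected graph on $n$ vertices with signless Laplacian eigenvalues $\mu_1^+,\dots,\mu_n^+$, and let $G^*$ be its extended double cover. Then the number of spanning trees $\tau(G^* )$ of $G^*$ is $$\tau(G^* )=\frac12\,\tau(G)\prod_{i=1}^{n}(\mu_i^++2).$$
   Context: $\tau(H)$ denotes the number of spanning trees of $H$. The signless Laplacian eigenvalues are the eigenvalues (with multiplicity) of $D+A$, with $A$ the adjacency matrix and $D$ the diagonal degree matrix. For $G$ with vertex set $\{v_1,\dots,v_n\}$, the extended double cover $G^*$ is the bipartite graph with parts $X=\{x_1,\dots,x_n\}$, $Y=\{y_1,\dots,y_n\}$, where $x_i$ is adjacent to $y_j$ iff $i=j$ or $v_i$ is adjacent to $v_j$ in $G$. *)

theory Defs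
  imports "Graph_Theory.Graph_Theory" "Jordan_Normal_Form.Char_Poly"
begin

text \<open>
  A finite simple undirected graph is a \<open>pair_graph\<close>: every undirected edge is represented
  by its two opposite arcs. In this representation \<open>pre_digraph.cycle\<close> also accepts the
  back-and-forth walk \<open>a, b, a\<close> along one edge, so the library's \<open>tree\<close> and
  \<open>spanning_tree\<close> are not the undirected notions. The cycles of the undirected graph
  are those of length at least 3.
\<close>

definition undirected_tree :: "'a pair_pre_digraph \<Rightarrow> bool" where
  "undirected_tree T \<longleftrightarrow> pair_graph T \<and> connected (with_proj T) \<and>
     \<not> (\<exists>p. pre_digraph.cycle (with_proj T) p \<and> 3 \<le> length p)"

definition spanning_trees :: "'a pair_pre_digraph \<Rightarrow> 'a pair_pre_digraph set" where
  "spanning_trees G = {T. undirected_tree T \<and> spanning (with_proj T) (with_proj G)}"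

definition num_spanning_trees :: "'a pair_pre_digraph \<Rightarrow> nat" where
  "num_spanning_trees G = card (spanning_trees G)"

text \<open>The vertices \<open>Inl u\<close> form the part \<open>X\<close>, the vertices \<open>Inr w\<close> the part \<open>Y\<close>.\<close>

definition extended_double_cover :: "'a pair_pre_digraph \<Rightarrow> ('a + 'a) pair_pre_digraph" where
  "extended_double_cover G =
     \<lparr> pverts = pverts G <+> pverts G,
       parcs = (\<Union>(u, w) \<in> {(u, w). u \<in> pverts G \<and> w \<in> pverts G \<and> (u = w \<or> (u, w) \<in> parcs G)}.
                  {(Inl u, Inr w), (Inr w, Inl u)}) \<rparr>"

text \<open>Matrices are taken with respect to an enumeration \<open>v 0, \<dots>, v (n - 1)\<close> of the vertices.\<close>

definition adjacency_matrix :: "nat \<Rightarrow> (nat \<Rightarrow> 'a) \<Rightarrow> 'a pair_pre_digraph \<Rightarrow> real mat" where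
  "adjacency_matrix n v G = mat n n (\<lambda>(i, j). if (v i, v j) \<in> parcs G then 1 else 0)"

definition degree_matrix :: "nat \<Rightarrow> (nat \<Rightarrow> 'a) \<Rightarrow> 'a pair_pre_digraph \<Rightarrow> real mat" where
  "degree_matrix n v G = mat_diag n (\<lambda>i. real (out_degree (with_proj G) (v i)))"

definition signless_laplacian :: "nat \<Rightarrow> (nat \<Rightarrow> 'a) \<Rightarrow> 'a pair_pre_digraph \<Rightarrow> real mat" where
  "signless_laplacian n v G = degree_matrix n v G + adjacency_matrix n v G"

text \<open>
  The eigenvalues, each repeated according to its algebraic multiplicity. Only real eigenvalues
  are collected, which for a symmetric matrix are all of them.
\<close>

definition eigenvalues_mset :: "real mat \<Rightarrow> real multiset" where
  "eigenvalues_mset A = proots (char_poly A)"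

end

theory Submission
  imports Defs
begin

text \<open>
  Write \<open>L = D - A\<close> for the Laplacian and \<open>Q = D + A\<close> for the signless Laplacian of \<open>G\<close>. With the parts
  \<open>X\<close> and \<open>Y\<close> enumerated in the same order, the Laplacian of the double cover is the block matrix with
  \<open>D + 1\<close> in both diagonal blocks and \<open>-(A + 1)\<close> in the two others. A matrix of this shape splits into
  its actions on symmetric and on antisymmetric vectors, which here are \<open>L\<close> and \<open>Q + 2\<close>. Hence
  \<open>det (x + L*) = det (x + L) det (x + Q + 2)\<close> (lemmas \<open>char_poly_four_block_swap\<close> and
  \<open>uminus_laplacian_extended_double_cover\<close>).

  By Kirchhoff's theorem the derivative of \<open>det (x + L)\<close> at \<open>0\<close>, a sum of \<open>n\<close> principal cofactors, is \<open>n\<close>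
  times the number of spanning trees (\<open>pderiv_char_poly_uminus_laplacian\<close>). Since \<open>det L = 0\<close>, comparing
  derivatives at \<open>0\<close> gives \<open>2 n \<tau>(G*) = n \<tau>(G) det (Q + 2)\<close>. As \<open>Q\<close> is real symmetric, its
  characteristic polynomial splits over the reals, and \<open>det (Q + 2)\<close> is the product of the numbers
  \<open>\<mu> + 2\<close> (\<open>det_symmetric_plus_scalar\<close>).

  Kirchhoff's theorem (\<open>matrix_tree\<close>) is proved by expanding the determinant multilinearly in the rows.
  Each row but that of the root \<open>r\<close> chooses one neighbour, so the terms are indexed by functions \<open>f\<close> on the
  vertices; a term is \<open>1\<close> if all vertices reach \<open>r\<close> by iterating \<open>f\<close> and \<open>0\<close> otherwise
  (\<open>det_functional_digraph\<close>). The surviving functions are the parent maps of the spanning trees rooted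
  at \<open>r\<close> (\<open>num_spanning_trees_eq_card_parent_maps\<close>).
\<close>

section \<open>Spanning trees as parent maps\<close>

text \<open>
  A spanning tree rooted at \<open>r\<close> is recorded by the map that sends every other vertex to the next
  vertex on its path to \<open>r\<close>. The value outside \<open>V - {r}\<close> is pinned to the identity so that each
  rooted tree corresponds to exactly one function and the set can be counted; in particular
  \<open>r\<close> is a fixed point, so an iterate that has reached \<open>r\<close> stays there. The vertex set and the
  arc relation are separate parameters because the same notion is also used on the indices
  of a matrix.
\<close>

definition parent_maps :: "'a set \<Rightarrow> 'a rel \<Rightarrow> 'a \<Rightarrow> ('a \<Rightarrow> 'a) set" where
  "parent_maps V E r = {f. (\<forall>x\<in>V - {r}. (x, f x) \<in> E) \<and>
     (\<forall>x. x \<notin> V - {r} \<longrightarrow> f x = x) \<and> (\<forall>x\<in>V. \<exists>k. (f ^^ k) x = r)}"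

definition tree_of :: "'a pair_pre_digraph \<Rightarrow> 'a \<Rightarrow> ('a \<Rightarrow> 'a) \<Rightarrow> 'a pair_pre_digraph" where
  "tree_of G r f = \<lparr> pverts = pverts G, parcs = (\<Union>x\<in>pverts G - {r}. {(x, f x), (f x, x)}) \<rparr>"

lemma pverts_tree_of [simp]: "pverts (tree_of G r f) = pverts G"
  by (simp add: tree_of_def)

lemma in_parcs_tree_of:
  "(a, b) \<in> parcs (tree_of G r f) \<longleftrightarrow>
     a \<in> pverts G - {r} \<and> b = f a \<or> b \<in> pverts G - {r} \<and> a = f b"
  by (auto simp: tree_of_def)

lemma parent_mapsD:
  assumes "f \<in> parent_maps V E r"
  shows "x \<in> V - {r} \<Longrightarrow> (x, f x) \<in> E" "x \<notin> V - {r} \<Longrightarrow> f x = x"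
    "x \<in> V \<Longrightarrow> \<exists>k. (f ^^ k) x = r"
  using assms unfolding parent_maps_def by auto

lemma iterates_reach_root_induct [consumes 1, case_names root step]:
  assumes "\<exists>k. (f ^^ k) x = r" and "P r" and "\<And>y. y \<noteq> r \<Longrightarrow> P (f y) \<Longrightarrow> P y"
  shows "P x"
proof -
  from assms(1) obtain k where "(f ^^ k) x = r" ..
  thus ?thesis
  proof (induction k arbitrary: x)
    case (Suc k)
    hence "P (f x)" by (simp add: funpow_swap1)
    thus ?case using assms(2,3) by (cases "x = r") auto
  qed (use assms(2) in simp)
qed

text \<open>
  Suppose that two parent maps \<open>f\<close>, \<open>g\<close> have the same edges but differ at \<open>x\<close>. The edge from \<open>x\<close> to
  \<open>f x\<close> must come from \<open>g\<close> in the opposite direction, so \<open>g (f x) = x\<close>, whereas \<open>f (f x) = x\<close> would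
  trap the iterates of \<open>f\<close> in a 2-cycle. So they differ at \<open>f x\<close> too, and the disagreement
  travels along \<open>f\<close> up to the root, where it is impossible.
\<close>

lemma inj_on_tree_of: "inj_on (tree_of G r) (parent_maps (pverts G) (parcs G) r)"
proof (rule inj_onI)
  fix f g assume f: "f \<in> parent_maps (pverts G) (parcs G) r" and g: "g \<in> parent_maps (pverts G) (parcs G) r"
    and eq: "tree_of G r f = tree_of G r g"
  have step: "f (f x) \<noteq> g (f x) \<and> f x \<in> pverts G - {r}"
    if x: "x \<in> pverts G - {r}" and ne: "f x \<noteq> g x" for x
  proof -
    have "(x, f x) \<in> parcs (tree_of G r g)" using x by (simp add: eq[symmetric] in_parcs_tree_of)
    hence fx: "f x \<in> pverts G - {r}" "g (f x) = x" using ne by (auto simp: in_parcs_tree_of)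
    have "f (f x) \<noteq> x"
    proof
      assume loop: "f (f x) = x"
      have "(f ^^ k) x \<in> {x, f x}" for k by (induction k) (auto simp: loop)
      moreover obtain k where "(f ^^ k) x = r" using parent_mapsD(3)[OF f, of x] x by blast
      ultimately have "r \<in> {x, f x}" by metis
      thus False using x fx(1) by blast
    qed
    thus ?thesis using fx by simp
  qed
  show "f = g"
  proof
    fix x
    show "f x = g x"
    proof (cases "x \<in> pverts G - {r}")
      case True
      have "y \<in> pverts G - {r} \<longrightarrow> f y = g y" if "\<exists>k. (f ^^ k) y = r" for y
        using that by (induction rule: iterates_reach_root_induct) (use step in auto)
      thus ?thesis using True parent_mapsD(3)[OF f] by auto
    qed (use parent_mapsD(2)[OF f] parent_mapsD(2)[OF g] in auto)
  qed
qed

lemma pcas_nth_step: "pcas u p w \<Longrightarrow> Suc i < length p \<Longrightarrow> fst (p ! Suc i) = snd (p ! i)"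
proof (induction p arbitrary: u i)
  case (Cons e p)
  thus ?case by (cases i; cases p) auto
qed simp

lemma pcas_last: "pcas u p w \<Longrightarrow> p \<noteq> [] \<Longrightarrow> snd (last p) = w"
  by (induction p arbitrary: u) auto

lemma closed_pcas_nth:
  assumes "pcas u p u" "i < length p"
  shows "fst (p ! (Suc i mod length p)) = snd (p ! i)"
proof (cases "Suc i < length p")
  case True
  thus ?thesis using pcas_nth_step[OF assms(1)] by simp
next
  case False
  hence i: "Suc i = length p" using assms(2) by simp
  moreover have "fst (p ! 0) = u" using assms by (cases p) auto
  moreover have "p ! i = last p" using i assms(2) by (metis diff_Suc_1 last_conv_nth list.size(3) not_less0)
  ultimately show ?thesis using pcas_last[OF assms(1)] assms(2) by fastforce
qed

lemma cyclic_predecessor: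
  assumes "i < (n :: nat)"
  obtains j where "j < n" "Suc j mod n = i"
proof (cases i)
  case 0
  thus ?thesis using assms by (intro that[of "n - 1"]) auto
next
  case (Suc j)
  thus ?thesis using assms by (intro that[of j]) auto
qed

lemma tl_pawalk_verts: "pcas u p w \<Longrightarrow> tl (pawalk_verts u p) = map snd p"
proof (induction p arbitrary: u)
  case (Cons e p)
  thus ?case by (cases p) auto
qed simp

text \<open>
  The one place where the length of a cycle matters: if two consecutive arcs led from \<open>a\<close> to \<open>w\<close>
  and back to \<open>a\<close>, then the arc before them and the second of them would both end in \<open>a\<close>, so by
  distinctness of the heads they are the same arc, and the cycle has length at most 2.
\<close>

lemma long_cycle_distinct_ends:
  assumes "pcas u p u" "distinct (map snd p)" "3 \<le> length p" "i < length p"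
  shows "fst (p ! i) \<noteq> snd (p ! (Suc i mod length p))"
proof
  let ?n = "length p"
  assume eq: "fst (p ! i) = snd (p ! (Suc i mod ?n))"
  obtain j where j: "j < ?n" "Suc j mod ?n = i" using cyclic_predecessor[OF assms(4)] .
  have "snd (p ! j) = snd (p ! (Suc i mod ?n))"
    using closed_pcas_nth[OF assms(1) j(1)] j(2) eq by simp
  moreover have "Suc i mod ?n < ?n" using j(1) by (intro mod_less_divisor) linarith
  ultimately have "j = Suc i mod ?n"
    using assms(2) j(1) nth_eq_iff_index_eq[of "map snd p" j "Suc i mod ?n"] by simp
  moreover have "Suc i mod ?n = (j + 2) mod ?n" using j(2) by (metis add_2_eq_Suc' mod_Suc_eq)
  ultimately have "(j + 2) mod ?n = j mod ?n" using j(1) by simp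
  hence "?n dvd 2" by (metis add_diff_cancel_left' le_add1 mod_eq_dvd_iff_nat)
  thus False using assms(3) dvd_imp_le[of ?n 2] by simp
qed

lemma mk_symmetric_id:
  assumes "pair_sym_digraph T"
  shows "mk_symmetric (with_proj T) = T"
proof -
  interpret pair_sym_digraph T by fact
  have "parcs (mk_symmetric (with_proj T)) = parcs T"
    using arcs_symmetric by (auto simp: mk_symmetric_def)
  thus ?thesis by (simp add: mk_symmetric_def)
qed

context
  fixes G :: "'a pair_pre_digraph" and r :: 'a and f :: "'a \<Rightarrow> 'a"
  assumes G: "pair_graph G" and r: "r \<in> pverts G" and f: "f \<in> parent_maps (pverts G) (parcs G) r"
begin

interpretation G: pair_graph G by (rule G)

lemma tree_of_parcs_subset: "parcs (tree_of G r f) \<subseteq> parcs G"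
  using parent_mapsD(1)[OF f] G.arcs_symmetric by (force simp: tree_of_def)

lemma pair_graph_tree_of: "pair_graph (tree_of G r f)"
proof
  fix e assume "e \<in> parcs (tree_of G r f)"
  hence "e \<in> parcs G" using tree_of_parcs_subset by blast
  thus "fst e \<in> pverts (tree_of G r f)" "snd e \<in> pverts (tree_of G r f)" "fst e \<noteq> snd e"
    using G.pair_no_loops G.arc_fst_in_verts G.arc_snd_in_verts by auto
next
  show "finite (parcs (tree_of G r f))"
    using tree_of_parcs_subset G.pair_finite_arcs by (rule finite_subset)
  show "symmetric (with_proj (tree_of G r f))"
    by (auto simp: symmetric_def sym_def in_parcs_tree_of)
qed (use G.pair_finite_verts in simp)

interpretation T: pair_graph "tree_of G r f" by (rule pair_graph_tree_of)

lemma reachable_root_tree_of: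
  assumes "x \<in> pverts G"
  shows "reachable (with_proj (tree_of G r f)) x r"
proof -
  have "x \<in> pverts G \<longrightarrow> reachable (with_proj (tree_of G r f)) x r"
    using parent_mapsD(3)[OF f assms]
  proof (induction rule: iterates_reach_root_induct)
    case (step y)
    show ?case
    proof
      assume y: "y \<in> pverts G"
      hence "(y, f y) \<in> parcs (tree_of G r f)" using step by (simp add: in_parcs_tree_of)
      thus "reachable (with_proj (tree_of G r f)) y r"
        using step.IH T.arc_snd_in_verts[of "(y, f y)"] by (auto intro: T.adj_reachable_trans)
    qed
  qed (use r in auto)
  thus ?thesis using assms by simp
qed

lemma reachable_tree_of:
  assumes "x \<in> pverts G" "y \<in> pverts G"
  shows "reachable (with_proj (tree_of G r f)) x y"
  using reachable_root_tree_of assms T.symmetric_reachable' T.reachable_trans by metis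

text \<open>
  On a cycle, look at a vertex \<open>w\<close> that is farthest from the root. Its two neighbours on the cycle are not
  farther, so neither is a child of \<open>w\<close> and both are the parent of \<open>w\<close>; a cycle of length at least 3
  cannot enter and leave a vertex through the same neighbour.
\<close>

lemma no_long_cycle_tree_of:
  assumes "T.cycle p"
  shows "length p < 3"
proof (rule ccontr)
  assume "\<not> length p < 3"
  hence n: "3 \<le> length p" by simp
  define d where "d x = (LEAST k. (f ^^ k) x = r)" for x
  have d_step: "d x = Suc (d (f x))" if "x \<in> pverts G - {r}" for x
  proof -
    have "x \<in> pverts G" using that by blast
    then obtain k where "(f ^^ k) x = r" using parent_mapsD(3)[OF f] by blast
    thus ?thesis unfolding d_def using that by (subst Least_Suc) (auto simp: funpow_swap1)
  qed
  obtain u where u: "pcas u p u" "set p \<subseteq> parcs (tree_of G r f)" "distinct (map snd p)"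
    using assms tl_pawalk_verts unfolding T.cycle_def T.awalk_def by metis
  define M where "M = Max ((\<lambda>e. d (snd e)) ` set p)"
  have "M \<in> (\<lambda>e. d (snd e)) ` set p" unfolding M_def using n by (intro Max_in) auto
  then obtain i where i: "i < length p" "d (snd (p ! i)) = M" by (auto simp: in_set_conv_nth)
  have le: "d (snd (p ! k)) \<le> M" if "k < length p" for k
    unfolding M_def using that by (intro Max_ge) auto
  let ?i' = "Suc i mod length p"
  have i': "?i' < length p" using i(1) by (intro mod_less_divisor) linarith
  define w where "w = snd (p ! i)"
  have up: "b = f w" if "(b, w) \<in> parcs (tree_of G r f)" "d b \<le> M" for b
    using that d_step[of b] i(2) by (auto simp: in_parcs_tree_of w_def)
  have "(fst (p ! i), w) \<in> parcs (tree_of G r f)" "(w, snd (p ! ?i')) \<in> parcs (tree_of G r f)"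
    using u(2) i(1) i' closed_pcas_nth[OF u(1) i(1)] nth_mem unfolding w_def
    by (metis prod.collapse subsetD)+
  moreover have "d (fst (p ! i)) \<le> M"
  proof -
    obtain j where j: "j < length p" "Suc j mod length p = i" using cyclic_predecessor[OF i(1)] .
    thus ?thesis using closed_pcas_nth[OF u(1) j(1)] le[OF j(1)] by simp
  qed
  ultimately have "fst (p ! i) = f w" "snd (p ! ?i') = f w"
    using up le[OF i'] T.arcs_symmetric by blast+
  thus False using long_cycle_distinct_ends[OF u(1,3) n i(1)] by simp
qed

lemma tree_of_in_spanning_trees: "tree_of G r f \<in> spanning_trees G"
proof -
  have "connected (with_proj (tree_of G r f))"
    unfolding connected_def mk_symmetric_id[OF T.pair_sym_digraph_axioms] strongly_connected_def
    using r reachable_tree_of by auto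
  moreover have "spanning (with_proj (tree_of G r f)) (with_proj G)"
    unfolding spanning_def subgraph_def
    using tree_of_parcs_subset T.wf_digraph_axioms G.wf_digraph_axioms by auto
  ultimately show ?thesis
    unfolding spanning_trees_def undirected_tree_def
    using pair_graph_tree_of no_long_cycle_tree_of by fastforce
qed

end

text \<open>
  Given a spanning tree \<open>T\<close>, let each vertex choose a neighbour in \<open>T\<close> that is closer to the root.
  The resulting edges lie in \<open>T\<close> and already connect all vertices, so a further edge of \<open>T\<close>
  would close a cycle of length at least 3 in \<open>T\<close>.
\<close>

lemma spanning_tree_eq_tree_of:
  assumes G: "pair_graph G" and r: "r \<in> pverts G" and T: "T \<in> spanning_trees G"
  shows "\<exists>f\<in>parent_maps (pverts G) (parcs G) r. tree_of G r f = T"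
proof -
  interpret T: pair_graph T using T by (simp add: spanning_trees_def undirected_tree_def)
  have V: "pverts T = pverts G" and sub: "parcs T \<subseteq> parcs G"
    using T by (auto simp: spanning_trees_def spanning_def subgraph_def)
  have acyc: "length p < 3" if "T.cycle p" for p
    using T that by (fastforce simp: spanning_trees_def undirected_tree_def)
  have conn: "reachable (with_proj T) x r" if "x \<in> pverts G" for x
    using T that r mk_symmetric_id[OF T.pair_sym_digraph_axioms] V
    by (auto simp: spanning_trees_def undirected_tree_def connected_def strongly_connected_def)
  \<comment> \<open>The distance to the root in \<open>T\<close>.\<close>
  define d where "d x = (LEAST k. (x, r) \<in> parcs T ^^ k)" for x
  have closer: "\<exists>y. (x, y) \<in> parcs T \<and> d y < d x" if x: "x \<in> pverts G - {r}" for x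
  proof -
    have "(x, r) \<in> (parcs T)\<^sup>*" using conn[of x] x
      by (auto simp: reachable_def intro: rtrancl_on_rtranclI)
    hence *: "(x, r) \<in> parcs T ^^ d x" unfolding d_def rtrancl_power by (rule LeastI_ex)
    moreover have "d x \<noteq> 0" using * x by (auto intro: gr0I)
    then obtain m where m: "d x = Suc m" using not0_implies_Suc by blast
    ultimately obtain y where "(x, y) \<in> parcs T" "(y, r) \<in> parcs T ^^ m"
      by (metis relpow_Suc_D2)
    moreover from this have "d y \<le> m" unfolding d_def by (intro Least_le)
    ultimately show ?thesis using m by auto
  qed
  define f where "f x = (if x \<in> pverts G - {r} then SOME y. (x, y) \<in> parcs T \<and> d y < d x else x)" for x
  have fT: "(x, f x) \<in> parcs T" "d (f x) < d x" if "x \<in> pverts G - {r}" for x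
    using someI_ex[OF closer[OF that]] that by (auto simp: f_def)
  have reach: "\<exists>k. (f ^^ k) x = r" if "x \<in> pverts G" for x
    using that
  proof (induction "d x" arbitrary: x rule: less_induct)
    case less
    show ?case
    proof (cases "x = r")
      case False
      hence "x \<in> pverts G - {r}" using less.prems by simp
      from fT[OF this] obtain k where "(f ^^ k) (f x) = r"
        using less.hyps[of "f x"] T.in_arcsD2 V by auto
      hence "(f ^^ Suc k) x = r" by (simp add: funpow_swap1)
      thus ?thesis ..
    qed (auto intro: exI[of _ 0])
  qed
  have f: "f \<in> parent_maps (pverts G) (parcs G) r"
    using fT sub reach by (auto simp: parent_maps_def f_def)
  have le: "parcs (tree_of G r f) \<subseteq> parcs T"
    using fT(1) T.arcs_symmetric by (auto simp: tree_of_def)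
  interpret S: pair_graph "tree_of G r f" by (rule pair_graph_tree_of[OF G r f])
  have "(a, b) \<in> parcs (tree_of G r f)" if ab: "(a, b) \<in> parcs T" for a b
  proof (rule ccontr)
    assume not: "(a, b) \<notin> parcs (tree_of G r f)"
    have "a \<in> pverts G" "b \<in> pverts G" using T.in_arcsD1[OF ab] T.in_arcsD2[OF ab] V by auto
    then obtain p where p: "S.apath b p a"
      using reachable_tree_of[OF G r f] S.reachable_apath by blast
    have "p \<noteq> []" using p T.no_loops'[OF ab] by (auto simp: S.apath_def S.awalk_def)
    moreover have "p \<noteq> [e]" for e
      using p not S.arcs_symmetric[of b a] by (cases e) (auto simp: S.apath_def S.awalk_def)
    ultimately have "3 \<le> length ((a, b) # p)" by (cases p rule: remdups_adj.cases) auto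
    moreover have "T.cycle ((a, b) # p)"
      using p ab le T.in_arcsD1[OF ab] 
      by (auto simp: T.cycle_def S.apath_def S.awalk_def T.awalk_def)
    ultimately show False using acyc by fastforce
  qed
  hence "parcs (tree_of G r f) = parcs T" using le by auto
  hence "tree_of G r f = T" using V by (simp add: tree_of_def)
  thus ?thesis using f by blast
qed

lemma num_spanning_trees_eq_card_parent_maps:
  assumes "pair_graph G" "r \<in> pverts G"
  shows "num_spanning_trees G = card (parent_maps (pverts G) (parcs G) r)"
proof -
  have "bij_betw (tree_of G r) (parent_maps (pverts G) (parcs G) r) (spanning_trees G)"
    unfolding bij_betw_def
    using inj_on_tree_of tree_of_in_spanning_trees[OF assms] spanning_tree_eq_tree_of[OF assms]
    by (force simp: image_iff)
  thus ?thesis by (simp add: num_spanning_trees_def bij_betw_same_card)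
qed

lemma relabel_parent_map:
  assumes f: "f \<in> parent_maps V E r" and E: "E \<subseteq> V \<times> V" and r: "r \<in> V"
    and v: "v ` V \<subseteq> W" and w: "w ` W \<subseteq> V"
    and wv: "\<And>i. i \<in> V \<Longrightarrow> w (v i) = i" and vw: "\<And>y. y \<in> W \<Longrightarrow> v (w y) = y"
    and hom: "\<And>i j. (i, j) \<in> E \<Longrightarrow> (v i, v j) \<in> F"
  shows "(\<lambda>y. if y \<in> W then v (f (w y)) else y) \<in> parent_maps W F (v r)"
proof -
  let ?g = "\<lambda>y. if y \<in> W then v (f (w y)) else y"
  have fV: "f i \<in> V" if "i \<in> V" for i
    using parent_mapsD(1,2)[OF f, of i] E that by (cases "i = r") auto
  have fr: "f r = r" using parent_mapsD(2)[OF f] by simp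
  have iter: "(f ^^ k) i \<in> V \<and> (?g ^^ k) (v i) = v ((f ^^ k) i)" if "i \<in> V" for i k
    by (induction k) (use that fV v wv in auto)
  have "(y, ?g y) \<in> F" if "y \<in> W - {v r}" for y
  proof -
    have "w y \<in> V - {r}" using that w vw by auto
    hence "(v (w y), v (f (w y))) \<in> F" using parent_mapsD(1)[OF f] hom by blast
    thus ?thesis using that vw by simp
  qed
  moreover have "?g y = y" if "y \<notin> W - {v r}" for y
    using that v r wv fr by auto
  moreover have "\<exists>k. (?g ^^ k) y = v r" if "y \<in> W" for y
  proof -
    have "w y \<in> V" using w that by blast
    moreover from this obtain k where "(f ^^ k) (w y) = r" using parent_mapsD(3)[OF f] by blast
    ultimately have "(?g ^^ k) (v (w y)) = v r" using iter by metis
    thus ?thesis using vw[OF that] by auto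
  qed
  ultimately show ?thesis unfolding parent_maps_def by blast
qed

text \<open>
  Transport from vertices to matrix indices along an enumeration.
\<close>

lemma card_parent_maps_relabel:
  assumes v: "bij_betw v V W" and r: "r \<in> V" and F: "F \<subseteq> W \<times> W"
  shows "card (parent_maps V {(i, j). i \<in> V \<and> j \<in> V \<and> (v i, v j) \<in> F} r) = card (parent_maps W F (v r))"
proof -
  let ?E = "{(i, j). i \<in> V \<and> j \<in> V \<and> (v i, v j) \<in> F}"
  define w where "w = inv_into V v"
  have vV: "v ` V \<subseteq> W" using v by (simp add: bij_betw_def)
  have wW: "w ` W \<subseteq> V" using bij_betw_inv_into[OF v] by (simp add: bij_betw_def w_def)
  have wv: "w (v i) = i" if "i \<in> V" for i using v that by (simp add: w_def bij_betw_inv_into_left)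
  have vw: "v (w y) = y" if "y \<in> W" for y using v that by (simp add: w_def bij_betw_inv_into_right)
  have inV: "f i \<in> V" if "f \<in> parent_maps V ?E r" "i \<in> V" for f i
    using parent_mapsD(1,2)[OF that(1), of i] that(2) by (cases "i = r") auto
  have inW: "g y \<in> W" if "g \<in> parent_maps W F (v r)" "y \<in> W" for g y
    using parent_mapsD(1,2)[OF that(1), of y] that(2) F by (cases "y = v r") auto
  have "bij_betw (\<lambda>f y. if y \<in> W then v (f (w y)) else y) (parent_maps V ?E r) (parent_maps W F (v r))"
  proof (rule bij_betw_byWitness[where f' = "\<lambda>g i. if i \<in> V then w (g (v i)) else i"])
    have "(if i \<in> V then w (if v i \<in> W then v (f (w (v i))) else v i) else i) = f i"
      if f: "f \<in> parent_maps V ?E r" for f i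
      using parent_mapsD(2)[OF f, of i] inV[OF f, of i] vV wv by (cases "i \<in> V") auto
    thus "\<forall>f\<in>parent_maps V ?E r. (\<lambda>i. if i \<in> V then w (if v i \<in> W then v (f (w (v i))) else v i) else i) = f"
      by blast
    have "(if y \<in> W then v (if w y \<in> V then w (g (v (w y))) else w y) else y) = g y"
      if g: "g \<in> parent_maps W F (v r)" for g y
      using parent_mapsD(2)[OF g, of y] inW[OF g, of y] wW vw by (cases "y \<in> W") auto
    thus "\<forall>g\<in>parent_maps W F (v r). (\<lambda>y. if y \<in> W then v (if w y \<in> V then w (g (v (w y))) else w y) else y) = g"
      by blast
    show "(\<lambda>f y. if y \<in> W then v (f (w y)) else y) ` parent_maps V ?E r \<subseteq> parent_maps W F (v r)"
    proof (rule image_subsetI)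
      fix f assume f: "f \<in> parent_maps V ?E r"
      show "(\<lambda>y. if y \<in> W then v (f (w y)) else y) \<in> parent_maps W F (v r)"
        by (rule relabel_parent_map[OF f _ r vV wW wv vw]) auto
    qed
    show "(\<lambda>g i. if i \<in> V then w (g (v i)) else i) ` parent_maps W F (v r) \<subseteq> parent_maps V ?E r"
    proof (rule image_subsetI)
      fix g assume g: "g \<in> parent_maps W F (v r)"
      have "(w a, w b) \<in> ?E" if "(a, b) \<in> F" for a b
        using that F wW vw by auto
      moreover have "v r \<in> W" using r vV by blast
      ultimately show "(\<lambda>i. if i \<in> V then w (g (v i)) else i) \<in> parent_maps V ?E r"
        using relabel_parent_map[OF g F _ wW vV vw wv, of ?E] wv[OF r] by simp
    qed
  qed
  thus ?thesis by (rule bij_betw_same_card)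
qed

section \<open>Determinants and functional digraphs\<close>

text \<open>
  The matrix is \<open>1 - P\<close>, where \<open>P\<close> is the 0/1 matrix of \<open>f\<close> with the row of \<open>r\<close> erased. If every iterate
  sequence reaches \<open>r\<close>, only the identity contributes to the Leibniz formula: a permutation with a
  nonzero product that moves some \<open>i\<close> agrees with \<open>f\<close> along the whole orbit of \<open>i\<close> under \<open>f\<close>, so it
  moves every point of this orbit, but it fixes \<open>r\<close>. If some sequence never reaches \<open>r\<close>, the
  indicator vector of the points with this property is in the kernel.
\<close>

lemma det_functional_digraph:
  fixes f :: "nat \<Rightarrow> nat"
  assumes r: "r < n" "f r = r" and f: "\<And>i. i < n \<Longrightarrow> f i < n"
  shows "det (mat n n (\<lambda>(i, j). of_bool (i = j) - of_bool (i \<noteq> r \<and> f i = j)))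
       = (of_bool (\<forall>i<n. \<exists>k. (f ^^ k) i = r) :: real)"
proof (cases "\<forall>i<n. \<exists>k. (f ^^ k) i = r")
  case reach: True
  let ?M = "mat n n (\<lambda>(i, j). of_bool (i = j) - of_bool (i \<noteq> r \<and> f i = j)) :: real mat"
  have M: "?M \<in> carrier_mat n n" by simp
  have no_fix: "f i \<noteq> i" if "i < n" "i \<noteq> r" for i
  proof
    assume "f i = i"
    hence "(f ^^ k) i = i" for k by (induction k) auto
    thus False using reach that by auto
  qed
  have zero: "(\<Prod>i = 0..<n. ?M $$ (i, p i)) = 0" if p: "p permutes {0..<n}" "p \<noteq> id" for p
  proof (rule ccontr)
    assume "(\<Prod>i = 0..<n. ?M $$ (i, p i)) \<noteq> 0"
    hence nz: "?M $$ (i, p i) \<noteq> 0" if "i < n" for i using that by auto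
    have pn: "p i < n" if "i < n" for i using permutes_in_image[OF p(1)] that by auto
    have p_cases: "p i = i \<or> i \<noteq> r \<and> p i = f i" if "i < n" for i
      using nz[OF that] pn[OF that] that by (auto split: if_splits)
    obtain i where i: "p i \<noteq> i" using p(2) by (auto simp: fun_eq_iff)
    have "i < n" using i p(1) by (meson atLeastLessThan_iff permutes_not_in zero_le)
    \<comment> \<open>A moved point is sent to its image under \<open>f\<close>, and by injectivity that image is moved as well.\<close>
    have moved: "(f ^^ k) i < n \<and> p ((f ^^ k) i) \<noteq> (f ^^ k) i" for k
    proof (induction k)
      case (Suc k)
      let ?j = "(f ^^ k) i"
      have "p ?j = f ?j" using Suc p_cases by blast
      moreover have "p (p ?j) \<noteq> p ?j" using Suc permutes_inj[OF p(1)] by (auto dest: injD)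
      ultimately show ?case using Suc f by simp
    qed (use i \<open>i < n\<close> in simp)
    obtain k where "(f ^^ k) i = r" using reach \<open>i < n\<close> by blast
    thus False using moved[of k] p_cases[OF r(1)] by auto
  qed
  have "det ?M = (\<Sum>p | p permutes {0..<n}. signof p * (\<Prod>i = 0..<n. ?M $$ (i, p i)))"
    by (rule det_def'[OF M])
  also have "\<dots> = (\<Sum>p\<in>{id}. signof p * (\<Prod>i = 0..<n. ?M $$ (i, p i)))"
  proof (rule sum.mono_neutral_right)
    show "\<forall>p\<in>{p. p permutes {0..<n}} - {id}. signof p * (\<Prod>i = 0..<n. ?M $$ (i, p i)) = 0"
    proof
      fix p assume "p \<in> {p. p permutes {0..<n}} - {id}"
      hence "p permutes {0..<n}" "p \<noteq> id" by simp_all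
      from zero[OF this] show "signof p * (\<Prod>i = 0..<n. ?M $$ (i, p i)) = 0"
        by (simp only: mult_zero_right)
    qed
  qed (simp_all add: finite_permutations permutes_id)
  also have "(\<Prod>i = 0..<n. ?M $$ (i, id i)) = 1" using no_fix by (intro prod.neutral) auto
  hence "(\<Sum>p\<in>{id}. signof p * (\<Prod>i = 0..<n. ?M $$ (i, p i))) = 1" by (simp add: sign_id)
  finally show ?thesis using reach by simp
next
  case False
  let ?M = "mat n n (\<lambda>(i, j). of_bool (i = j) - of_bool (i \<noteq> r \<and> f i = j)) :: real mat"
  define x :: "real vec" where "x = vec n (\<lambda>i. of_bool (\<nexists>k. (f ^^ k) i = r))"
  obtain i where i: "i < n" "\<nexists>k. (f ^^ k) i = r" using False by blast
  have x_step: "(\<exists>k. (f ^^ k) (f j) = r) \<longleftrightarrow> (\<exists>k. (f ^^ k) j = r)" if ne: "j \<noteq> r" for j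
  proof
    assume "\<exists>k. (f ^^ k) (f j) = r"
    then obtain k where "(f ^^ Suc k) j = r" by (auto simp: funpow_swap1)
    thus "\<exists>k. (f ^^ k) j = r" by blast
  next
    assume "\<exists>k. (f ^^ k) j = r"
    then obtain k where k: "(f ^^ k) j = r" by blast
    then obtain m where "k = Suc m" using ne by (cases k) auto
    thus "\<exists>k. (f ^^ k) (f j) = r" using k by (auto simp: funpow_swap1)
  qed
  have "?M *\<^sub>v x = 0\<^sub>v n"
  proof (rule eq_vecI)
    fix j assume "j < dim_vec (0\<^sub>v n :: real vec)"
    hence j: "j < n" by simp
    have "(?M *\<^sub>v x) $ j = (\<Sum>l = 0..<n. (of_bool (j = l) - of_bool (j \<noteq> r \<and> f j = l)) * x $ l)"
      using j by (simp add: scalar_prod_def x_def)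
    also have "\<dots> = (\<Sum>l = 0..<n. of_bool (j = l) * x $ l) - (\<Sum>l = 0..<n. of_bool (j \<noteq> r \<and> f j = l) * x $ l)"
      by (simp add: left_diff_distrib sum_subtractf)
    also have "\<dots> = x $ j - of_bool (j \<noteq> r) * x $ f j"
    proof -
      have pick: "(\<Sum>l = 0..<n. of_bool (m = l) * x $ l) = x $ m" if "m < n" for m
      proof -
        have "(\<Sum>l = 0..<n. of_bool (m = l) * x $ l) = (\<Sum>l = 0..<n. if l = m then x $ l else 0)"
          by (rule sum.cong) auto
        thus ?thesis using that by simp
      qed
      show ?thesis using pick[OF j] pick[OF f[OF j]] by (cases "j = r") simp_all
    qed
    also have "\<dots> = 0"
    proof (cases "j = r")
      case True
      have "(f ^^ 0) r = r" by simp
      hence "\<exists>k. (f ^^ k) r = r" by blast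
      thus ?thesis using True r by (simp add: x_def)
    next
      case False
      have "x $ f j = x $ j" using j f[OF j] by (simp only: x_def index_vec x_step[OF False])
      thus ?thesis using False by simp
    qed
    finally show "(?M *\<^sub>v x) $ j = 0\<^sub>v n $ j" using j by simp
  qed (simp add: x_def)
  moreover have "x \<noteq> 0\<^sub>v n"
  proof
    assume "x = 0\<^sub>v n"
    hence "x $ i = 0" using i(1) by simp
    thus False using i by (simp add: x_def)
  qed
  moreover have "x \<in> carrier_vec n" by (simp add: x_def)
  ultimately have "\<exists>x. x \<in> carrier_vec n \<and> x \<noteq> 0\<^sub>v n \<and> ?M *\<^sub>v x = 0\<^sub>v n" by blast
  hence "det ?M = 0" by (subst det_0_iff_vec_prod_zero[of _ n]) simp_all
  thus ?thesis using False by simp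
qed

text \<open>
  Row \<open>i\<close> of the Laplacian is the sum of \<open>e_i - e_k\<close> over the neighbours \<open>k\<close> of \<open>i\<close>. Expanding all rows but
  that of \<open>r\<close> by multilinearity lets every index \<open>i\<close> choose a neighbour \<open>f i\<close>, and
  \<open>det_functional_digraph\<close> selects the choices that are parent maps.
\<close>

lemma det_rooted_laplacian:
  fixes E :: "nat rel"
  assumes r: "r < n" and E: "E \<subseteq> {..<n} \<times> {..<n}"
  shows "det (mat n n (\<lambda>(i, j). if i = r then of_bool (j = r)
           else of_bool (i = j) * real (card {k. k < n \<and> (i, k) \<in> E}) - of_bool ((i, j) \<in> E)))
       = real (card (parent_maps {..<n} E r))"
proof -
  let ?L = "mat n n (\<lambda>(i, j). if i = r then of_bool (j = r)
     else of_bool (i = j) * real (card {k. k < n \<and> (i, k) \<in> E}) - of_bool ((i, j) \<in> E))"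
  let ?T = "{0..<n} - {r}"
  \<comment> \<open>Summing over all \<open>k < n\<close>, with the zero vector at non-neighbours, gives each row the same index set.\<close>
  define a :: "nat \<Rightarrow> nat \<Rightarrow> real vec" where
    "a i k = (if (i, k) \<in> E then unit_vec n i - unit_vec n k else 0\<^sub>v n)" for i k
  define c :: "nat \<Rightarrow> real vec" where "c i = (if i = r then unit_vec n r else 0\<^sub>v n)" for i
  define \<Phi> where "\<Phi> = {f. (\<forall>i\<in>?T. f i \<in> {0..<n}) \<and> (\<forall>i. i \<notin> ?T \<longrightarrow> f i = i)}"
  have a: "a i k \<in> carrier_vec n" for i k by (simp add: a_def)
  have "?L = mat\<^sub>r n n (\<lambda>i. if i \<in> ?T then finsum_vec TYPE(real) n (a i) {0..<n} else c i)" (is "_ = ?R")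
  proof (rule eq_matI)
    fix i j assume "i < dim_row ?R" "j < dim_col ?R"
    hence ij: "i < n" "j < n" by auto
    show "?L $$ (i, j) = ?R $$ (i, j)"
    proof (cases "i = r")
      case True
      thus ?thesis using ij r by (simp add: c_def)
    next
      case False
      have "?R $$ (i, j) = (\<Sum>k = 0..<n. a i k $ j)"
        using False ij a by (simp add: index_finsum_vec)
      also have "\<dots> = (\<Sum>k = 0..<n. of_bool (i = j) * of_bool ((i, k) \<in> E) - of_bool (k = j \<and> (i, j) \<in> E))"
        using ij by (intro sum.cong) (auto simp: a_def)
      also have "\<dots> = of_bool (i = j) * real (card {k. k < n \<and> (i, k) \<in> E}) - of_bool ((i, j) \<in> E)"
      proof -
        have "(\<Sum>k = 0..<n. of_bool ((i, k) \<in> E)) = real (card {k. k < n \<and> (i, k) \<in> E})"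
          by (simp add: of_bool_def sum.If_cases Int_def)
        moreover have "(\<Sum>k = 0..<n. of_bool (k = j \<and> (i, j) \<in> E)) = (of_bool ((i, j) \<in> E) :: real)"
          using ij by (cases "(i, j) \<in> E") (simp_all add: of_bool_def)
        ultimately show ?thesis by (simp only: sum_subtractf sum_distrib_left[symmetric])
      qed
      finally show ?thesis using False ij by simp
    qed
  qed auto
  also have "det \<dots> = (\<Sum>f\<in>\<Phi>. det (mat\<^sub>r n n (\<lambda>i. if i \<in> ?T then a i (f i) else c i)))"
    unfolding \<Phi>_def using a by (intro det_linear_rows_finsum_lemma) (auto simp: c_def)
  also have "\<dots> = (\<Sum>f\<in>\<Phi>. of_bool (f \<in> parent_maps {..<n} E r))"
  proof (rule sum.cong[OF refl])
    fix f assume f: "f \<in> \<Phi>"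
    have out: "f i = i" if "i \<notin> {..<n} - {r}" for i
      using f that unfolding \<Phi>_def by (auto simp: atLeast0LessThan)
    hence fr: "f r = r" by simp
    have fn: "f i < n" if "i < n" for i
      using f that fr unfolding \<Phi>_def by (cases "i = r") auto
    let ?D = "mat\<^sub>r n n (\<lambda>i. if i \<in> ?T then a i (f i) else c i)"
    show "det ?D = of_bool (f \<in> parent_maps {..<n} E r)"
    proof (cases "\<forall>i\<in>?T. (i, f i) \<in> E")
      case True
      have "?D = mat n n (\<lambda>(i, j). of_bool (i = j) - of_bool (i \<noteq> r \<and> f i = j))"
        using True fn by (intro eq_matI) (auto simp: a_def c_def)
      moreover have "f \<in> parent_maps {..<n} E r \<longleftrightarrow> (\<forall>i<n. \<exists>k. (f ^^ k) i = r)"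
        using True out by (auto simp: parent_maps_def)
      ultimately show ?thesis using det_functional_digraph[of r n f] r fr fn by simp
    next
      case False
      then obtain i where "i \<in> ?T" and iE: "(i, f i) \<notin> E" by blast
      hence i: "i < n" "i \<noteq> r" by auto
      have "det ?D = det (mat\<^sub>r n n (\<lambda>l. if l = i then 0\<^sub>v n else (if l \<in> ?T then a l (f l) else c l)))"
        using i iE by (intro arg_cong[of _ _ det] eq_matI) (auto simp: a_def)
      also have "\<dots> = 0" using i a by (intro det_row_0) (auto simp: c_def)
      finally show ?thesis using i iE by (auto simp: parent_maps_def)
    qed
  qed
  also have "\<dots> = real (card (parent_maps {..<n} E r))"
  proof -
    have "f i < n" if "f \<in> parent_maps {..<n} E r" "i < n" "i \<noteq> r" for f i
      using parent_mapsD(1)[OF that(1), of i] that E by auto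
    moreover have "f i = i" if "f \<in> parent_maps {..<n} E r" "i \<notin> {0..<n} - {r}" for f i
      using parent_mapsD(2)[OF that(1), of i] that(2) by (simp add: atLeast0LessThan)
    ultimately have "parent_maps {..<n} E r \<subseteq> \<Phi>" unfolding \<Phi>_def by fastforce
    moreover have "finite \<Phi>" unfolding \<Phi>_def by (rule finite_bounded_functions) auto
    ultimately show ?thesis by (simp add: of_bool_def sum.If_cases Int_absorb1)
  qed
  finally show ?thesis .
qed

section \<open>Kirchhoff's matrix tree theorem\<close>

definition laplacian :: "nat \<Rightarrow> (nat \<Rightarrow> 'a) \<Rightarrow> 'a pair_pre_digraph \<Rightarrow> real mat" where
  "laplacian n v G = degree_matrix n v G - adjacency_matrix n v G"

lemma laplacian_carrier [simp]: "laplacian n v G \<in> carrier_mat n n"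
  unfolding laplacian_def adjacency_matrix_def by (rule minus_carrier_mat) simp

lemma out_degree_eq_card:
  assumes "pair_graph G" "bij_betw v {..<n} (pverts G)" "i < n"
  shows "out_degree (with_proj G) (v i) = card {k. k < n \<and> (v i, v k) \<in> parcs G}"
proof -
  interpret pair_graph G by fact
  have "bij_betw (\<lambda>k. (v i, v k)) {k. k < n \<and> (v i, v k) \<in> parcs G} (out_arcs (with_proj G) (v i))"
    unfolding bij_betw_def
  proof
    show "inj_on (\<lambda>k. (v i, v k)) {k. k < n \<and> (v i, v k) \<in> parcs G}"
      using assms(2) by (auto simp: inj_on_def bij_betw_def)
    show "(\<lambda>k. (v i, v k)) ` {k. k < n \<and> (v i, v k) \<in> parcs G} = out_arcs (with_proj G) (v i)"
    proof
      show "out_arcs (with_proj G) (v i) \<subseteq> (\<lambda>k. (v i, v k)) ` {k. k < n \<and> (v i, v k) \<in> parcs G}"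
      proof
        fix e assume "e \<in> out_arcs (with_proj G) (v i)"
        then obtain y where e: "e = (v i, y)" "(v i, y) \<in> parcs G" by (cases e) auto
        hence "y \<in> v ` {..<n}" using assms(2) in_arcsD2 by (simp add: bij_betw_def)
        thus "e \<in> (\<lambda>k. (v i, v k)) ` {k. k < n \<and> (v i, v k) \<in> parcs G}" using e by auto
      qed
    qed auto
  qed
  thus ?thesis by (simp add: out_degree_def bij_betw_same_card)
qed

lemma index_laplacian:
  assumes "pair_graph G" "bij_betw v {..<n} (pverts G)" "i < n" "j < n"
  shows "laplacian n v G $$ (i, j)
    = of_bool (i = j) * real (card {k. k < n \<and> (v i, v k) \<in> parcs G}) - of_bool ((v i, v j) \<in> parcs G)"
  using assms out_degree_eq_card[OF assms(1-3)]
  by (auto simp: laplacian_def degree_matrix_def adjacency_matrix_def mat_diag_def)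

text \<open>
  All rows sum to zero, so the all-ones vector is in the kernel.
\<close>

lemma det_laplacian:
  assumes G: "pair_graph G" "bij_betw v {..<n} (pverts G)" and n: "0 < n"
  shows "det (laplacian n v G) = 0"
proof -
  have "laplacian n v G *\<^sub>v vec n (\<lambda>_. 1) = 0\<^sub>v n"
  proof (rule eq_vecI)
    fix i assume "i < dim_vec (0\<^sub>v n :: real vec)"
    hence i: "i < n" by simp
    have "(laplacian n v G *\<^sub>v vec n (\<lambda>_. 1)) $ i = (\<Sum>j = 0..<n. laplacian n v G $$ (i, j))"
      using i carrier_matD[OF laplacian_carrier[of n v G]] by (simp add: scalar_prod_def)
    also have "\<dots> = (\<Sum>j = 0..<n. of_bool (i = j) * real (card {k. k < n \<and> (v i, v k) \<in> parcs G})
        - of_bool ((v i, v j) \<in> parcs G))"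
      using i by (intro sum.cong) (auto simp: index_laplacian[OF G])
    also have "\<dots> = 0"
      using i by (simp add: sum_subtractf sum_distrib_right[symmetric] of_bool_def sum.If_cases Int_def)
    finally show "(laplacian n v G *\<^sub>v vec n (\<lambda>_. 1)) $ i = 0\<^sub>v n $ i" using i by simp
  qed (use carrier_matD[OF laplacian_carrier[of n v G]] in simp)
  moreover have "vec n (\<lambda>_. 1) \<noteq> (0\<^sub>v n :: real vec)"
    using n by (metis index_vec index_zero_vec(1) zero_neq_one)
  ultimately show ?thesis
    using det_0_iff_vec_prod_zero[OF laplacian_carrier] by (metis vec_carrier)
qed

text \<open>
  Kirchhoff's theorem for principal cofactors. Deleting row and column \<open>r\<close> has the same effect on the
  determinant as replacing row \<open>r\<close> by the unit vector \<open>e_r\<close>.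
\<close>

theorem matrix_tree:
  assumes G: "pair_graph G" "bij_betw v {..<n} (pverts G)" and r: "r < n"
  shows "det (mat_delete (laplacian n v G) r r) = real (num_spanning_trees G)"
proof -
  interpret pair_graph G by (rule G)
  let ?E = "{(i, j). i \<in> {..<n} \<and> j \<in> {..<n} \<and> (v i, v j) \<in> parcs G}"
  let ?L = "laplacian n v G"
  let ?R = "mat n n (\<lambda>(i, j). if i = r then of_bool (j = r) else ?L $$ (i, j))"
  have "det ?R = (\<Sum>j<n. ?R $$ (r, j) * cofactor ?R r j)"
    using r by (intro laplace_expansion_row) auto
  also have "\<dots> = (\<Sum>j<n. if j = r then cofactor ?R r r else 0)"
    using r by (intro sum.cong) auto
  also have "\<dots> = det (mat_delete ?R r r)" using r by (simp add: cofactor_def)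
  also have "mat_delete ?R r r = mat_delete ?L r r"
    using carrier_matD[OF laplacian_carrier[of n v G]] by (intro eq_matI) (auto simp: mat_delete_def)
  finally have "det (mat_delete ?L r r) = det ?R" by simp
  also have "?R = mat n n (\<lambda>(i, j). if i = r then of_bool (j = r)
      else of_bool (i = j) * real (card {k. k < n \<and> (i, k) \<in> ?E}) - of_bool ((i, j) \<in> ?E))"
    by (intro eq_matI) (auto simp: index_laplacian[OF G] intro!: arg_cong[of _ _ card])
  also have "det \<dots> = real (card (parent_maps {..<n} ?E r))"
    by (rule det_rooted_laplacian[OF r]) auto
  also have "\<dots> = real (card (parent_maps (pverts G) (parcs G) (v r)))"
  proof -
    have "parcs G \<subseteq> pverts G \<times> pverts G" using in_arcsD1 in_arcsD2 by auto
    thus ?thesis using card_parent_maps_relabel[OF G(2), of r "parcs G"] r by simp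
  qed
  also have "v r \<in> pverts G" using G(2) r by (auto simp: bij_betw_def)
  hence "card (parent_maps (pverts G) (parcs G) (v r)) = num_spanning_trees G"
    using num_spanning_trees_eq_card_parent_maps[OF G(1)] by simp
  finally show ?thesis .
qed

text \<open>
  The derivative of \<open>det (x + L)\<close> at \<open>x = 0\<close> is the sum of the \<open>n\<close> principal cofactors of \<open>L\<close>. The
  Laplacian is negated so that no signs \<open>(-1)^n\<close> appear.
\<close>

lemma pderiv_char_poly_uminus_laplacian:
  assumes G: "pair_graph G" "bij_betw v {..<n} (pverts G)"
  shows "poly (pderiv (char_poly (- laplacian n v G))) 0 = real n * real (num_spanning_trees G)"
proof -
  let ?L = "laplacian n v G"
  have "poly (char_poly (mat_delete (- ?L) i i)) 0 = real (num_spanning_trees G)" if "i < n" for i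
  proof -
    have M: "mat_delete (- ?L) i i \<in> carrier_mat (n - 1) (n - 1)"
      by (rule mat_delete_carrier) simp
    have "- char_matrix (mat_delete (- ?L) i i) 0 = mat_delete ?L i i"
      using that carrier_matD[OF laplacian_carrier[of n v G]]
      by (intro eq_matI) (auto simp: char_matrix_def mat_delete_def)
    thus ?thesis using char_poly_matrix[OF M, of 0] matrix_tree[OF G that] by simp
  qed
  thus ?thesis by (simp add: pderiv_char_poly[of _ n] poly_sum)
qed

section \<open>Block matrices with equal diagonal blocks\<close>

text \<open>
  In the coordinates \<open>(x - y, y)\<close> the matrix becomes block triangular, because the swap of the two
  blocks acts as \<open>1\<close> on symmetric and as \<open>-1\<close> on antisymmetric vectors. The conjugation is written
  with unipotent matrices, so that it works over any integral domain, in particular over polynomials.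
\<close>

lemma det_four_block_swap:
  fixes A B :: "'a :: idom mat"
  assumes A: "A \<in> carrier_mat n n" and B: "B \<in> carrier_mat n n"
  shows "det (four_block_mat A B B A) = det (A + B) * det (A - B)"
proof -
  let ?I = "1\<^sub>m n :: 'a mat" and ?Z = "0\<^sub>m n n :: 'a mat"
  let ?U = "four_block_mat ?I (- ?I) ?Z ?I" and ?W = "four_block_mat ?I ?I ?Z ?I"
  have U: "det ?U = 1" and W: "det ?W = 1"
    by (subst det_four_block_mat_lower_left_zero[of _ n _ n]; simp)+
  have carr: "four_block_mat A B B A \<in> carrier_mat (n + n) (n + n)"
    "?U \<in> carrier_mat (n + n) (n + n)" "?W \<in> carrier_mat (n + n) (n + n)"
    using A B by auto
  have "?U * four_block_mat A B B A = four_block_mat (A - B) (B - A) B A"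
    using A B by (subst mult_four_block_mat[of _ n n _ n _ n _ _ n _ n]) auto
  also have "\<dots> * ?W = four_block_mat (A - B) ?Z B (A + B)"
    using A B by (subst mult_four_block_mat[of _ n n _ n _ n _ _ n _ n]) 
      (auto intro!: cong_four_block_mat eq_matI)
  finally have "det (?U * four_block_mat A B B A * ?W) = det (A - B) * det (A + B)"
    using det_four_block_mat_upper_right_zero[of "A - B" n ?Z n B "A + B"] A B
    by (simp add: minus_carrier_mat[OF B])
  thus ?thesis using U W carr by (simp add: det_mult[of _ "n + n"] mult.commute)
qed

lemma char_poly_four_block_swap:
  fixes P Q :: "'a :: idom mat"
  assumes P: "P \<in> carrier_mat n n" and Q: "Q \<in> carrier_mat n n"
  shows "char_poly (four_block_mat P Q Q P) = char_poly (P + Q) * char_poly (P - Q)"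
proof -
  let ?q = "map_mat (\<lambda>a. [:- a:]) Q"
  have "char_poly_matrix (four_block_mat P Q Q P)
      = four_block_mat (char_poly_matrix P) ?q ?q (char_poly_matrix P)"
    using P Q by (intro eq_matI) (auto simp: char_poly_matrix_def four_block_mat_def Let_def)
  moreover have "char_poly_matrix P + ?q = char_poly_matrix (P + Q)"
    using P Q by (intro eq_matI) (auto simp: char_poly_matrix_def)
  moreover have "char_poly_matrix P - ?q = char_poly_matrix (P - Q)"
    using P Q by (intro eq_matI) (auto simp: char_poly_matrix_def)
  ultimately show ?thesis
    using P Q det_four_block_swap[of "char_poly_matrix P" n ?q] by (simp add: char_poly_def)
qed

section \<open>The spectrum of a real symmetric matrix\<close>

text \<open>
  For an eigenvector \<open>x\<close>, moving the real symmetric matrix from one side of the inner product of \<open>x\<close> with itself to the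
  other replaces the eigenvalue by its conjugate.
\<close>

lemma eigenvalue_symmetric_real:
  fixes A :: "real mat"
  assumes A: "A \<in> carrier_mat n n" and sym: "A\<^sup>T = A"
    and ev: "eigenvalue (map_mat complex_of_real A) a"
  shows "a \<in> \<real>"
proof -
  let ?C = "map_mat complex_of_real A"
  have C: "?C \<in> carrier_mat n n" using A by simp
  obtain x where x: "x \<in> carrier_vec n" "x \<noteq> 0\<^sub>v n" "?C *\<^sub>v x = a \<cdot>\<^sub>v x"
    using ev A unfolding eigenvalue_def eigenvector_def by auto
  have cC: "?C *\<^sub>v conjugate x = conjugate (?C *\<^sub>v x)"
    using A x(1) by (intro eq_vecI) (auto simp: scalar_prod_def cnj_sum)
  have symC: "?C\<^sup>T = ?C" by (subst map_mat_transpose) (simp add: sym)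
  have "a * (x \<bullet> conjugate x) = (?C *\<^sub>v x) \<bullet> conjugate x"
    using x by simp
  also have "\<dots> = x \<bullet> (?C *\<^sub>v conjugate x)"
    using transpose_vec_mult_scalar[OF C, of "conjugate x" x] x(1) symC by simp
  also have "\<dots> = cnj a * (x \<bullet> conjugate x)"
    unfolding cC x(3) using x(1) by (simp add: conjugate_smult_vec)
  finally have "a = cnj a" using x by simp
  thus ?thesis by (simp add: complex_is_Real_iff complex_eq_iff)
qed

text \<open>
  Over the complex numbers the characteristic polynomial is a product of linear factors; all of its
  roots are real, so the factorization descends to the reals. This is what makes the multiset of real
  roots the complete spectrum.
\<close>

lemma char_poly_symmetric_splits:
  fixes A :: "real mat"
  assumes A: "A \<in> carrier_mat n n" and sym: "A\<^sup>T = A"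
  shows "char_poly A = (\<Prod>\<mu>\<in>#proots (char_poly A). [:- \<mu>, 1:])"
proof -
  interpret h: map_poly_comm_ring_hom complex_of_real ..
  let ?C = "map_mat complex_of_real A"
  have C: "?C \<in> carrier_mat n n" using A by simp
  obtain as where as: "char_poly ?C = (\<Prod>a\<leftarrow>as. [:- a, 1:])"
    using char_poly_factorized[OF C] by blast
  have "complex_of_real (Re a) = a" if "a \<in> set as" for a
  proof -
    have "poly (char_poly ?C) a = 0" unfolding as using that 
      by (auto simp: poly_prod_list prod_list_zero_iff)
    hence "a \<in> \<real>" using eigenvalue_symmetric_real[OF A sym] eigenvalue_root_char_poly[OF C] by blast
    thus ?thesis by (simp)
  qed
  hence "(\<Prod>a\<leftarrow>as. [:- a, 1:]) = map_poly complex_of_real (\<Prod>a\<leftarrow>as. [:- Re a, 1:])"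
  proof (induction as)
    case (Cons a as)
    then show ?case by (simp add: h.hom_mult del: mult_pCons_left mult_pCons_right)
  qed simp
  hence "map_poly complex_of_real (char_poly A) = map_poly complex_of_real (\<Prod>a\<leftarrow>as. [:- Re a, 1:])"
    using as of_real_hom.char_poly_hom[OF A, where ?'a = complex] by simp
  hence *: "char_poly A = (\<Prod>a\<leftarrow>as. [:- Re a, 1:])"
    by (simp add: poly_eq_iff coeff_map_poly)
  have "proots (\<Prod>a\<leftarrow>as. [:- Re a, 1:]) = mset (map Re as)"
    by (induction as) (auto simp: proots_mult prod_list_zero_iff image_iff simp del: mult_pCons_left mult_pCons_right)
  thus ?thesis unfolding * by (simp add: prod_mset_prod_list[symmetric] multiset.map_comp o_def)
qed

lemma det_symmetric_plus_scalar:
  fixes A :: "real mat"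
  assumes A: "A \<in> carrier_mat n n" and sym: "A\<^sup>T = A"
  shows "det (A + c \<cdot>\<^sub>m 1\<^sub>m n) = (\<Prod>\<mu>\<in>#eigenvalues_mset A. \<mu> + c)"
proof -
  let ?R = "proots (char_poly A)"
  have "Polynomial.degree (\<Prod>\<mu>\<in>#M. [:- \<mu>, 1:]) = size M" for M :: "real multiset"
    by (induction M)
      (auto simp: degree_mult_eq prod_mset_zero_iff image_iff simp del: mult_pCons_left mult_pCons_right)
  hence n: "size ?R = n"
    using char_poly_symmetric_splits[OF A sym] degree_monic_char_poly[OF A] by metis
  have "poly (\<Prod>\<mu>\<in>#M. [:- \<mu>, 1:]) (- c) = (-1) ^ size M * (\<Prod>\<mu>\<in>#M. \<mu> + c)" for M :: "real multiset"
    by (induction M) (auto simp: algebra_simps)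
  hence "poly (char_poly A) (- c) = (-1) ^ n * (\<Prod>\<mu>\<in>#?R. \<mu> + c)"
    using char_poly_symmetric_splits[OF A sym] n by metis
  moreover have "poly (char_poly A) (- c) = (-1) ^ n * det (A + c \<cdot>\<^sub>m 1\<^sub>m n)"
  proof -
    have "- char_matrix A (- c) = (-1) \<cdot>\<^sub>m (A + c \<cdot>\<^sub>m 1\<^sub>m n)"
      using A by (intro eq_matI) (auto simp: char_matrix_def)
    thus ?thesis using A by (simp add: char_poly_matrix[OF A])
  qed
  ultimately show ?thesis unfolding eigenvalues_mset_def by simp
qed

section \<open>The extended double cover\<close>

lemma pair_graph_extended_double_cover:
  assumes "pair_graph G"
  shows "pair_graph (extended_double_cover G)"
proof -
  interpret pair_graph G by fact
  have sub: "parcs (extended_double_cover G)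
      \<subseteq> (pverts G <+> pverts G) \<times> (pverts G <+> pverts G)"
    by (auto simp: extended_double_cover_def)
  show ?thesis
  proof
    show "finite (pverts (extended_double_cover G))"
      using pair_finite_verts by (simp add: extended_double_cover_def)
    show "finite (parcs (extended_double_cover G))"
      using sub pair_finite_verts by (auto intro: finite_subset)
    show "symmetric (with_proj (extended_double_cover G))"
      by (auto simp: symmetric_def sym_def extended_double_cover_def)
  qed (auto simp: extended_double_cover_def)
qed

text \<open>
  The first \<open>n\<close> indices enumerate the part \<open>X\<close> and the last \<open>n\<close> the part \<open>Y\<close>, in the same order, so that
  matrices of the double cover split into four \<open>n \<times> n\<close> blocks.
\<close>

definition double_cover_enum :: "nat \<Rightarrow> (nat \<Rightarrow> 'a) \<Rightarrow> nat \<Rightarrow> 'a + 'a" where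
  "double_cover_enum n v k = (if k < n then Inl (v k) else Inr (v (k - n)))"

lemma bij_betw_double_cover_enum:
  assumes "bij_betw v {..<n} (pverts G)"
  shows "bij_betw (double_cover_enum n v) {..<n + n} (pverts (extended_double_cover G))"
proof -
  have inj: "inj_on v {..<n}" and V: "pverts G = v ` {..<n}" using assms by (auto simp: bij_betw_def)
  have "inj_on (double_cover_enum n v) {..<n + n}"
  proof (rule inj_onI)
    fix x y assume "x \<in> {..<n + n}" "y \<in> {..<n + n}" "double_cover_enum n v x = double_cover_enum n v y"
    hence "x < n \<and> y < n \<and> v x = v y \<or>
        (\<not> x < n \<and> x - n < n) \<and> (\<not> y < n \<and> y - n < n) \<and> v (x - n) = v (y - n)"
      by (auto simp: double_cover_enum_def split: if_splits)
    hence "x < n \<and> y < n \<and> x = y \<or> \<not> x < n \<and> \<not> y < n \<and> x - n = y - n"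
      using inj by (auto dest: inj_onD)
    thus "x = y" by linarith
  qed
  moreover have "double_cover_enum n v ` {..<n + n} = pverts (extended_double_cover G)"
  proof
    show "pverts (extended_double_cover G) \<subseteq> double_cover_enum n v ` {..<n + n}"
    proof
      fix z assume "z \<in> pverts (extended_double_cover G)"
      then obtain k where "k < n" and "z = Inl (v k) \<or> z = Inr (v k)"
        by (auto simp: extended_double_cover_def V)
      hence "z = double_cover_enum n v k \<or> z = double_cover_enum n v (n + k)"
        by (auto simp: double_cover_enum_def)
      moreover have "k \<in> {..<n + n}" "n + k \<in> {..<n + n}" using \<open>k < n\<close> by auto
      ultimately show "z \<in> double_cover_enum n v ` {..<n + n}" by blast
    qed
  qed (auto simp: extended_double_cover_def V double_cover_enum_def)
  ultimately show ?thesis by (simp add: bij_betw_def)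
qed


text \<open>
  Both copies of a vertex have one neighbour more than the vertex itself, namely its twin; this adds
  \<open>1\<close> to the degree matrix in the diagonal blocks and to the adjacency matrix in the others.
\<close>

lemma uminus_laplacian_extended_double_cover:
  assumes G: "pair_graph G" and v: "bij_betw v {..<n} (pverts G)"
  defines "P \<equiv> - (degree_matrix n v G + 1\<^sub>m n)" and "Q \<equiv> adjacency_matrix n v G + 1\<^sub>m n"
  shows "- laplacian (n + n) (double_cover_enum n v) (extended_double_cover G) = four_block_mat P Q Q P"
proof -
  interpret pair_graph G by (rule G)
  let ?u = "double_cover_enum n v" and ?H = "extended_double_cover G"
  let ?N = "\<lambda>i. {k. k < n \<and> (v i, v k) \<in> parcs G}"
  have inj: "v i = v j \<longleftrightarrow> i = j" if "i < n" "j < n" for i j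
    using v that by (auto simp: bij_betw_def inj_on_def)
  have vV: "v i \<in> pverts G" if "i < n" for i using v that by (auto simp: bij_betw_def)
  have arc: "(Inl (v i), Inl (v j)) \<notin> parcs ?H" "(Inr (v i), Inr (v j)) \<notin> parcs ?H"
    "(Inl (v i), Inr (v j)) \<in> parcs ?H \<longleftrightarrow> i = j \<or> (v i, v j) \<in> parcs G"
    "(Inr (v i), Inl (v j)) \<in> parcs ?H \<longleftrightarrow> i = j \<or> (v i, v j) \<in> parcs G"
    if "i < n" "j < n" for i j
    using that inj vV arcs_symmetric by (auto simp: extended_double_cover_def)
  have nbrs: "insert i (?N i) = {k. k < n \<and> (i = k \<or> (v i, v k) \<in> parcs G)}" if "i < n" for i
    using that by auto
  have card_nbrs: "card {k. k < n \<and> (i = k \<or> (v i, v k) \<in> parcs G)} = Suc (card (?N i))" if "i < n" for i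
    unfolding nbrs[OF that, symmetric] using no_loops' by (subst card_insert_disjoint) auto
  have deg: "card {k. k < n + n \<and> (?u i, ?u k) \<in> parcs ?H} = Suc (card (?N (if i < n then i else i - n)))"
    if i: "i < n + n" for i
  proof (cases "i < n")
    case True
    have "bij_betw ((+) n) {k. k < n \<and> (i = k \<or> (v i, v k) \<in> parcs G)} {k. k < n + n \<and> (?u i, ?u k) \<in> parcs ?H}"
      using True arc
      by (intro bij_betwI[where g = "\<lambda>k. k - n"]) (auto simp: double_cover_enum_def split: if_splits)
    from bij_betw_same_card[OF this] show ?thesis using True card_nbrs[OF True] by simp
  next
    case False
    hence i': "i - n < n" using i by simp
    have "{k. k < n + n \<and> (?u i, ?u k) \<in> parcs ?H} = {k. k < n \<and> (i - n = k \<or> (v (i - n), v k) \<in> parcs G)}"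
      using False i' arc by (auto simp: double_cover_enum_def split: if_splits)
    thus ?thesis using False card_nbrs[OF i'] by simp
  qed
  have D: "degree_matrix n v G $$ (i, j) = of_bool (i = j) * real (card (?N i))" if "i < n" "j < n" for i j
    using that out_degree_eq_card[OF G v] by (auto simp: degree_matrix_def mat_diag_def)
  have A: "adjacency_matrix n v G $$ (i, j) = of_bool ((v i, v j) \<in> parcs G)" if "i < n" "j < n" for i j
    using that by (simp add: adjacency_matrix_def)
  have dims: "dim_row (degree_matrix n v G) = n" "dim_col (degree_matrix n v G) = n"
    "dim_row (adjacency_matrix n v G) = n" "dim_col (adjacency_matrix n v G) = n"
    by (simp_all add: degree_matrix_def adjacency_matrix_def mat_diag_def)
  have PQ: "P \<in> carrier_mat n n" "Q \<in> carrier_mat n n" by (auto simp: P_def Q_def dims)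
  note H = pair_graph_extended_double_cover[OF G] bij_betw_double_cover_enum[OF v]
  show ?thesis
  proof (rule eq_matI)
    fix i j assume "i < dim_row (four_block_mat P Q Q P)" "j < dim_col (four_block_mat P Q Q P)"
    hence ij: "i < n + n" "j < n + n" using PQ by auto
    have L: "(- laplacian (n + n) ?u ?H) $$ (i, j)
        = of_bool ((?u i, ?u j) \<in> parcs ?H) - of_bool (i = j) * real (Suc (card (?N (if i < n then i else i - n))))"
      using ij carrier_matD[OF laplacian_carrier[of "n + n" ?u ?H]]
      by (simp add: index_laplacian[OF H] deg)
    have R: "four_block_mat P Q Q P $$ (i, j) = (if (i < n) = (j < n)
         then P $$ (if i < n then i else i - n, if j < n then j else j - n)
         else Q $$ (if i < n then i else i - n, if j < n then j else j - n))"
      using ij PQ by auto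
    consider "i < n" "j < n" | "i < n" "\<not> j < n" | "\<not> i < n" "j < n" | "\<not> i < n" "\<not> j < n" by blast
    thus "(- laplacian (n + n) ?u ?H) $$ (i, j) = four_block_mat P Q Q P $$ (i, j)"
      unfolding L R using ij
      by cases (auto simp: double_cover_enum_def arc P_def Q_def D A dims no_loops' dest: no_loops')
  qed (use PQ carrier_matD[OF laplacian_carrier[of "n + n" ?u ?H]] in simp_all)
qed

theorem theorem3p5:
  fixes G :: "'a pair_pre_digraph" and n :: nat and v :: "nat \<Rightarrow> 'a"
  assumes "pair_graph G"
    and "bij_betw v {..<n} (pverts G)"
  shows "real (num_spanning_trees (extended_double_cover G)) =
    1 / 2 * real (num_spanning_trees G) *
      (\<Prod>\<mu>\<in>#eigenvalues_mset (signless_laplacian n v G). \<mu> + 2)"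
proof (cases "n = 0")
  case True
  hence "pverts G = {}" using assms(2) by (simp add: bij_betw_def)
  hence "spanning_trees G = {}" "spanning_trees (extended_double_cover G) = {}"
    by (auto simp: spanning_trees_def undirected_tree_def connected_def strongly_connected_def
      spanning_def extended_double_cover_def)
  thus ?thesis by (simp add: num_spanning_trees_def)
next
  case False
  interpret pair_graph G by fact
  let ?H = "extended_double_cover G" and ?u = "double_cover_enum n v"
  let ?L = "laplacian n v G" and ?S = "signless_laplacian n v G"
  let ?A = "adjacency_matrix n v G" and ?D = "degree_matrix n v G"
  let ?P = "- (?D + 1\<^sub>m n)" and ?Q = "?A + 1\<^sub>m n"
  let ?B = "?S + 2 \<cdot>\<^sub>m 1\<^sub>m n"
  have A: "?A \<in> carrier_mat n n" and D: "?D \<in> carrier_mat n n"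
    by (simp_all add: adjacency_matrix_def degree_matrix_def)
  have S: "?S \<in> carrier_mat n n" and B: "?B \<in> carrier_mat n n" using A D by (auto simp: signless_laplacian_def)
  have symS: "?S\<^sup>T = ?S"
    using arcs_symmetric
    by (intro eq_matI) (auto simp: signless_laplacian_def adjacency_matrix_def degree_matrix_def mat_diag_def)
  \<comment> \<open>On symmetric vectors the block matrix acts as \<open>-L\<close>, on antisymmetric ones as \<open>-(D + A + 2)\<close>.\<close>
  have "?P + ?Q = - ?L" using A D by (intro eq_matI) (auto simp: laplacian_def)
  moreover have "?P - ?Q = - ?B" using A D by (intro eq_matI) (auto simp: signless_laplacian_def)
  ultimately have factor: "char_poly (- laplacian (n + n) ?u ?H) = char_poly (- ?L) * char_poly (- ?B)"
    using uminus_laplacian_extended_double_cover[OF assms] char_poly_four_block_swap[of ?P n ?Q] A D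
    by simp
  have at_0: "poly (char_poly (- M)) 0 = det M" if "M \<in> carrier_mat n n" for M :: "real mat"
  proof -
    have "- char_matrix (- M) 0 = M" using that by (intro eq_matI) (auto simp: char_matrix_def)
    thus ?thesis using that char_poly_matrix[of "- M" n 0] by simp
  qed
  have "poly (char_poly (- ?L)) 0 = 0"
    using at_0[of ?L] det_laplacian[OF assms] False by simp
  \<comment> \<open>Product rule; the other term vanishes because \<open>0\<close> is a root of the first factor.\<close>
  hence "poly (pderiv (char_poly (- laplacian (n + n) ?u ?H))) 0
      = poly (pderiv (char_poly (- ?L))) 0 * det ?B"
    unfolding factor by (simp add: pderiv_mult at_0[OF B])
  \<comment> \<open>Kirchhoff on both sides; the double cover has \<open>2n\<close> vertices, whence the factor \<open>1/2\<close>.\<close>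
  hence "real (n + n) * real (num_spanning_trees ?H) = real n * real (num_spanning_trees G) * det ?B"
    using pderiv_char_poly_uminus_laplacian[OF assms]
      pderiv_char_poly_uminus_laplacian[OF pair_graph_extended_double_cover[OF assms(1)]
        bij_betw_double_cover_enum[OF assms(2)]] by simp
  hence "real (num_spanning_trees ?H) = 1 / 2 * real (num_spanning_trees G) * det ?B"
    using False by (simp add: field_simps)
  thus ?thesis using det_symmetric_plus_scalar[OF S symS, of 2] by simp
qed

end
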